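(* Let $(G,\leq)$ be a finitely generated ordered group, let $X$ be a finite set and $\phi : X^* \to G$ a surjective monoid homomorphism, and let $L \subseteq X^*$ be a language representing the positive cone $G_+$, i.e. $\phi(L) = G_+$. Denote by $\mathrm{Pref}(L)$ the language of prefixes of the words in $L$. If there exists a set $T$ of positive elements in $G$ such that $T$ is unbounded (with respect to $\leq$) from above in $G$ and \[ T^{-1} \subseteq \phi(\mathrm{Pref}(L)), \] then $L$ is not regular.
   Context: An order on a group $G$ means a total left order: a total order $\leq$ on $G$ such that $g \leq g'$ implies $hg \leq hg'$ for all $g, g', h \in G$. An ordered group $(G,\leq)$ is a group with a specific order. An element $g$ is positive if $e < g$, where $e$ is the identity of $G$, and the positive cone is $G_+ = \{g \in G \mid e < g\}$. $X^*$ denotes the free monoid on $X$; a language over $X$ is a subset of $X^*$; a language is regular if it is accepted by a finite state automaton. $\mathrm{Pref}(L) = \{w \in X^* \mid wu \in L \text{ for some } u \in X^*\}$. $T^{-1} = \{t^{-1} \mid t \in T\}$. A subset $T\subseteq G$ is unbounded from above if there is no $g \in G$ with $t \leq g$ for all $t \in T$. *)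

theory Defs
  imports "HOL-Algebra.Generated_Groups"
begin

definition finitely_generated :: "('a, 'm) monoid_scheme \<Rightarrow> bool" where
  "finitely_generated G \<longleftrightarrow> (\<exists>S \<subseteq> carrier G. finite S \<and> generate G S = carrier G)"

text \<open>
  Orders are only required to be invariant under multiplication from the left. The pair
  \<open>(g, g') \<in> R\<close> stands for \<open>g \<le> g'\<close>.
\<close>

locale ordered_group = group G for G (structure) +
  fixes R :: "('a \<times> 'a) set"
  assumes linear_order: "linear_order_on (carrier G) R"
    and left_invariant:
      "\<lbrakk>g \<in> carrier G; g' \<in> carrier G; h \<in> carrier G; (g, g') \<in> R\<rbrakk>
        \<Longrightarrow> (h \<otimes> g, h \<otimes> g') \<in> R"

definition positive_cone :: "('a, 'm) monoid_scheme \<Rightarrow> ('a \<times> 'a) set \<Rightarrow> 'a set" where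
  "positive_cone G R = {g \<in> carrier G. (\<one>\<^bsub>G\<^esub>, g) \<in> R \<and> \<one>\<^bsub>G\<^esub> \<noteq> g}"

definition unbounded_above :: "('a, 'm) monoid_scheme \<Rightarrow> ('a \<times> 'a) set \<Rightarrow> 'a set \<Rightarrow> bool" where
  "unbounded_above G R T \<longleftrightarrow> \<not> (\<exists>g \<in> carrier G. \<forall>t \<in> T. (t, g) \<in> R)"

definition free_monoid :: "'x set \<Rightarrow> 'x list monoid" where
  "free_monoid X = \<lparr>carrier = lists X, mult = (@), one = []\<rparr>"

definition Pref :: "'x set \<Rightarrow> 'x list set \<Rightarrow> 'x list set" where
  "Pref X L = {w \<in> lists X. \<exists>u \<in> lists X. w @ u \<in> L}"

text \<open>
  Automata may be nondeterministic, have several initial states and be incomplete;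
  deterministic automata are a special case.
\<close>

record ('x, 's) automaton =
  states :: "'s set"
  initial :: "'s set"
  final :: "'s set"
  transitions :: "('s \<times> 'x \<times> 's) set"

definition finite_automaton :: "'x set \<Rightarrow> ('x, 's) automaton \<Rightarrow> bool" where
  "finite_automaton X A \<longleftrightarrow>
     finite (states A) \<and> initial A \<subseteq> states A \<and> final A \<subseteq> states A \<and>
     transitions A \<subseteq> states A \<times> X \<times> states A"

fun run :: "('x, 's) automaton \<Rightarrow> 's \<Rightarrow> 'x list \<Rightarrow> 's \<Rightarrow> bool" where
  "run A p [] q \<longleftrightarrow> p = q"
| "run A p (x # w) q \<longleftrightarrow> (\<exists>r. (p, x, r) \<in> transitions A \<and> run A r w q)"

definition accepted :: "'x set \<Rightarrow> ('x, 's) automaton \<Rightarrow> 'x list set" where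
  "accepted X A = {w \<in> lists X. \<exists>p \<in> initial A. \<exists>q \<in> final A. run A p w q}"

text \<open>
  A definition cannot quantify over the type of states. Since there are only finitely many
  states, taking them to be natural numbers loses nothing; see \<open>regularI\<close> below.
\<close>

definition regular :: "'x set \<Rightarrow> 'x list set \<Rightarrow> bool" where
  "regular X L \<longleftrightarrow>
     (\<exists>A :: ('x, nat) automaton. finite_automaton X A \<and> accepted X A = L)"

lemma regularI:
  fixes A :: "('x, 's) automaton"
  assumes A: "finite_automaton X A" and L: "accepted X A = L"
  shows "regular X L"
proof -
  have fin: "finite (states A)" and ini: "initial A \<subseteq> states A"
    and fnl: "final A \<subseteq> states A" and tr: "transitions A \<subseteq> states A \<times> X \<times> states A"
    using A by (simp_all add: finite_automaton_def)
  obtain f :: "'s \<Rightarrow> nat" where inj: "inj_on f (states A)"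
    using finite_imp_inj_to_nat_seg[OF fin] by blast
  define B :: "('x, nat) automaton" where
    "B = \<lparr>states = f ` states A, initial = f ` initial A, final = f ` final A,
          transitions = (\<lambda>(p, x, q). (f p, x, f q)) ` transitions A\<rparr>"
  have B: "finite_automaton X B"
    using fin ini fnl tr unfolding finite_automaton_def B_def by auto
  have step: "(f p, x, r) \<in> transitions B \<longleftrightarrow> (\<exists>p'. r = f p' \<and> (p, x, p') \<in> transitions A)"
    if "p \<in> states A" for p x r
  proof
    assume "(f p, x, r) \<in> transitions B"
    then obtain p0 q0 where "(p0, x, q0) \<in> transitions A" "f p0 = f p" "r = f q0"
      by (auto simp: B_def)
    moreover from this have "p0 = p"
      using tr inj that by (auto dest: inj_onD)
    ultimately show "\<exists>p'. r = f p' \<and> (p, x, p') \<in> transitions A" by blast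
  next
    assume "\<exists>p'. r = f p' \<and> (p, x, p') \<in> transitions A"
    then show "(f p, x, r) \<in> transitions B" by (force simp: B_def)
  qed
  have run: "run B (f p) w (f q) \<longleftrightarrow> run A p w q"
    if "p \<in> states A" "q \<in> states A" for p w q
    using that
  proof (induction w arbitrary: p)
    case Nil
    then show ?case using inj by (auto dest: inj_onD)
  next
    case (Cons x w)
    have "run B (f p) (x # w) (f q) \<longleftrightarrow>
        (\<exists>p'. (p, x, p') \<in> transitions A \<and> run B (f p') w (f q))"
      using step[OF Cons.prems(1)] by auto
    also have "\<dots> \<longleftrightarrow> (\<exists>p'. (p, x, p') \<in> transitions A \<and> run A p' w q)"
      using tr Cons.IH Cons.prems(2) by blast
    finally show ?case by simp
  qed
  have "accepted X B = accepted X A"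
  proof -
    have "(\<exists>p \<in> initial B. \<exists>q \<in> final B. run B p w q) \<longleftrightarrow>
        (\<exists>p \<in> initial A. \<exists>q \<in> final A. run A p w q)" for w
      using run ini fnl by (auto simp: B_def) blast+
    then show ?thesis by (simp add: accepted_def)
  qed
  then show ?thesis using B L unfolding regular_def by blast
qed

end

theory Submission
  imports Defs
begin

text \<open>
  An automaton with finitely many states has a bounded memory: after reading a prefix of a word
  of \<open>L\<close>, it is in one of finitely many states from which a final state can be reached, and one
  completion per such state serves all prefixes that lead there. So a regular language admits a
  finite set \<open>U\<close> of words such that every prefix is completed to a word of \<open>L\<close> by
  some \<open>u \<in> U\<close> (\<open>regular_finite_completions\<close>).

  Now let \<open>w\<close> be a prefix with \<open>\<phi>(w) = t\<inverse>\<close>, and let \<open>u \<in> U\<close> complete it. Then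
  \<open>t\<inverse> \<phi>(u) > e\<close>, and left multiplication by \<open>t\<close> gives \<open>t < \<phi>(u)\<close>. If \<open>L\<close> were regular,
  every \<open>t \<in> T\<close> would thus lie below an element of the finite set \<open>\<phi>(U)\<close>, hence below its maximum,
  whereas \<open>T\<close> is unbounded.
\<close>

lemma run_append: "run A p (v @ w) q \<longleftrightarrow> (\<exists>r. run A p v r \<and> run A r w q)"
  by (induction v arbitrary: p) auto

lemma run_in_states:
  assumes "finite_automaton X A" "p \<in> states A" "run A p w q"
  shows "q \<in> states A"
  using assms(2,3)
proof (induction w arbitrary: p)
  case (Cons x w)
  then show ?case using assms(1) by (auto simp: finite_automaton_def)
qed simp

text \<open>
  Whether a word leads from a state to a final state does not depend on how that state was reached,
  so \<open>U\<close> needs only one word for each state from which a final state can be reached.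
\<close>

lemma regular_finite_completions:
  fixes X :: "'x set"
  assumes "regular X L"
  obtains U where "finite U" "U \<subseteq> lists X" "\<And>w. w \<in> Pref X L \<Longrightarrow> \<exists>u \<in> U. w @ u \<in> L"
proof -
  obtain A :: "('x, nat) automaton" where A: "finite_automaton X A" and L: "accepted X A = L"
    using assms by (auto simp: regular_def)
  define completes where
    "completes q u \<longleftrightarrow> u \<in> lists X \<and> (\<exists>f \<in> final A. run A q u f)" for q u
  define c where "c q = (SOME u. completes q u)" for q
  have c: "completes q (c q)" if "completes q u" for q u
    unfolding c_def using that by (rule someI)
  define U where "U = c ` {q \<in> states A. \<exists>u. completes q u}"
  show thesis
  proof
    show "finite U"
      using A by (simp add: U_def finite_automaton_def)
    show "U \<subseteq> lists X"
      using c by (auto simp: U_def completes_def)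
  next
    fix w assume "w \<in> Pref X L"
    then obtain u where w: "w \<in> lists X" and u: "u \<in> lists X" and "w @ u \<in> accepted X A"
      by (auto simp: Pref_def L)
    then obtain p q f where p: "p \<in> initial A" and pq: "run A p w q"
      and f: "f \<in> final A" "run A q u f"
      by (auto simp: accepted_def run_append)
    have "q \<in> states A"
      using run_in_states[OF A _ pq] p A by (auto simp: finite_automaton_def)
    moreover have "completes q u"
      using u f by (auto simp: completes_def)
    ultimately have "c q \<in> U" and "completes q (c q)"
      using c by (auto simp: U_def)
    moreover from this(2) have "w @ c q \<in> accepted X A"
      using w p pq by (auto simp: accepted_def completes_def run_append)
    ultimately show "\<exists>u \<in> U. w @ u \<in> L"
      using L by auto
  qed
qed

lemma linear_order_on_finite_bounded:
  assumes R: "linear_order_on A R" and "finite F" "F \<subseteq> A" "A \<noteq> {}"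
  shows "\<exists>b \<in> A. \<forall>x \<in> F. (x, b) \<in> R"
  using assms(2,3)
proof (induction F rule: finite_induct)
  case empty
  then show ?case using assms(4) by auto
next
  case (insert y F)
  then obtain b where b: "b \<in> A" "\<forall>x \<in> F. (x, b) \<in> R" and y: "y \<in> A" by auto
  have "refl_on A R" "trans R" "total_on A R"
    using R by (auto simp: linear_order_on_def partial_order_on_def preorder_on_def)
  then have "(y, b) \<in> R \<or> (b, y) \<in> R" "(y, y) \<in> R"
    using b(1) y by (metis total_on_def refl_onD)+
  then show ?case
    using b y \<open>trans R\<close> by (auto dest: transD)
qed

lemma (in ordered_group) le_if_inv_mult_positive:
  assumes t: "t \<in> carrier G" and g: "g \<in> carrier G"
    and pos: "inv t \<otimes> g \<in> positive_cone G R"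
  shows "(t, g) \<in> R"
proof -
  have "(t \<otimes> \<one>, t \<otimes> (inv t \<otimes> g)) \<in> R"
    using pos t g by (intro left_invariant) (auto simp: positive_cone_def)
  then show ?thesis
    using t g by (simp add: m_assoc[symmetric])
qed

theorem lemma3:
  fixes G :: "('a, 'm) monoid_scheme" and R :: "('a \<times> 'a) set"
    and X :: "'x set" and \<phi> :: "'x list \<Rightarrow> 'a" and L :: "'x list set"
  assumes "ordered_group G R"
    and "finitely_generated G"
    and "finite X"
    and "\<phi> \<in> epi (free_monoid X) G" and "\<phi> \<one>\<^bsub>free_monoid X\<^esub> = \<one>\<^bsub>G\<^esub>"
    and "L \<subseteq> lists X"
    and "\<phi> ` L = positive_cone G R"
    and "\<exists>T. T \<subseteq> positive_cone G R \<and> unbounded_above G R T \<and>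
           set_inv\<^bsub>G\<^esub> T \<subseteq> \<phi> ` Pref X L"
  shows "\<not> regular X L"
proof
  assume "regular X L"
  then obtain U where U: "finite U" "U \<subseteq> lists X"
    and completion: "\<And>w. w \<in> Pref X L \<Longrightarrow> \<exists>u \<in> U. w @ u \<in> L"
    by (rule regular_finite_completions) blast
  interpret ordered_group G R by fact
  obtain T where T: "T \<subseteq> positive_cone G R" and unb: "unbounded_above G R T"
    and inv_T: "set_inv\<^bsub>G\<^esub> T \<subseteq> \<phi> ` Pref X L"
    using assms(8) by auto
  have \<phi>_carrier: "\<phi> w \<in> carrier G" if "w \<in> lists X" for w
    using assms(4) that by (auto simp: epi_def hom_def free_monoid_def)
  have \<phi>_append: "\<phi> (v @ w) = \<phi> v \<otimes>\<^bsub>G\<^esub> \<phi> w" if "v \<in> lists X" "w \<in> lists X" for v w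
    using assms(4) that by (auto simp: epi_def hom_def free_monoid_def)
  have "\<phi> ` U \<subseteq> carrier G"
    using U(2) \<phi>_carrier by blast
  then obtain b where b: "b \<in> carrier G" "\<forall>g \<in> \<phi> ` U. (g, b) \<in> R"
    using linear_order_on_finite_bounded[OF linear_order, of "\<phi> ` U"] U(1) by blast
  have "(t, b) \<in> R" if "t \<in> T" for t
  proof -
    have t: "t \<in> carrier G"
      using that T by (auto simp: positive_cone_def)
    obtain w where w: "w \<in> Pref X L" "inv\<^bsub>G\<^esub> t = \<phi> w"
      using inv_T \<open>t \<in> T\<close> by (auto simp: SET_INV_def)
    obtain u where u: "u \<in> U" "w @ u \<in> L"
      using completion[OF w(1)] by blast
    have lists: "w \<in> lists X" "u \<in> lists X"
      using w(1) u(1) U(2) by (auto simp: Pref_def)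
    have "inv\<^bsub>G\<^esub> t \<otimes>\<^bsub>G\<^esub> \<phi> u \<in> positive_cone G R"
      using imageI[OF u(2), of \<phi>] assms(7) w(2) \<phi>_append[OF lists] by simp
    then have "(t, \<phi> u) \<in> R"
      by (intro le_if_inv_mult_positive t \<phi>_carrier lists)
    moreover have "(\<phi> u, b) \<in> R"
      using b u(1) by auto
    moreover have "trans R"
      using linear_order by (auto simp: linear_order_on_def partial_order_on_def preorder_on_def)
    ultimately show ?thesis
      by (meson transD)
  qed
  then show False
    using unb b(1) by (auto simp: unbounded_above_def)
qed

end
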